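(* For all integers $d\ge 1$ and $\delta\ge 1$, the integer $\lambda=\lambda(d,\delta)$ defined in the context minimizes the function $p\mapsto\psi(d,\delta,p)$ amongst all integers $p$ with $p\ge\delta d$; that is, $\psi(d,\delta,p)\ge\psi(d,\delta,\lambda)$ for every integer $p\ge\delta d$.
   Context: For integers $d,\delta,p\ge 1$ with $p\ge\delta d$, define $$\psi(d,\delta,p):=\frac{\delta d^2(p-\delta+1)}{p-\delta d+1}+d(p-\delta+1)-1.$$ For $d\ge 2$, put $p_1:=\delta d-1+\lfloor\delta\sqrt{d^2-d}\rfloor$ and $p_2:=p_1+1$ (both are $\ge\delta d$), and define $\lambda:=p_1$ if $\psi(d,\delta,p_1)\le\psi(d,\delta,p_2)$, and $\lambda:=p_2$ if $\psi(d,\delta,p_2)<\psi(d,\delta,p_1)$. For $d=1$, put $\lambda:=\delta$. Thus $\lambda$ depends on $d$ and $\delta$. *)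

theory Defs
  imports Complex_Main
begin

(* Meaningful only for p >= delta * d, where the denominator is at least 1. *)
definition psi :: "int \<Rightarrow> int \<Rightarrow> int \<Rightarrow> real" where
  "psi d \<delta> p =
     of_int (\<delta> * d\<^sup>2 * (p - \<delta> + 1)) / of_int (p - \<delta> * d + 1)
       + of_int (d * (p - \<delta> + 1)) - 1"

definition p1 :: "int \<Rightarrow> int \<Rightarrow> int" where
  "p1 d \<delta> = \<delta> * d - 1 + \<lfloor>of_int \<delta> * sqrt (of_int (d\<^sup>2 - d))\<rfloor>"

definition p2 :: "int \<Rightarrow> int \<Rightarrow> int" where
  "p2 d \<delta> = p1 d \<delta> + 1"

definition lam :: "int \<Rightarrow> int \<Rightarrow> int" where
  "lam d \<delta> =
     (if d = 1 then \<delta>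
      else if psi d \<delta> (p1 d \<delta>) \<le> psi d \<delta> (p2 d \<delta>) then p1 d \<delta> else p2 d \<delta>)"

end

theory Submission
  imports Defs
begin

text \<open>
  In terms of the denominator \<open>q = p - \<delta> * d + 1 \<ge> 1\<close>, the function becomes
  \<open>psi d \<delta> p = C + d * (q + K / q)\<close>, where \<open>K = \<delta>\<^sup>2 * (d\<^sup>2 - d)\<close> and \<open>C\<close> does not depend
  on \<open>p\<close> (\<open>psi_eq\<close>). The map \<open>q \<mapsto> q + K / q\<close> falls up to \<open>sqrt K\<close> and rises afterwards
  (\<open>add_divide_diff\<close>), so over the positive integers its minimum is attained at
  \<open>\<lfloor>sqrt K\<rfloor>\<close> or at \<open>\<lfloor>sqrt K\<rfloor> + 1\<close>. These two values of \<open>q\<close> correspond to \<open>p1\<close> and \<open>p2\<close>,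
  and \<open>lam\<close> picks the better one. For \<open>d = 1\<close> the constant \<open>K\<close> vanishes, the function is
  increasing in \<open>q\<close>, and the minimum is at \<open>q = 1\<close>, that is, at \<open>p = \<delta>\<close>.
\<close>

lemma psi_eq:
  assumes "p \<ge> \<delta> * d"
  shows "psi d \<delta> p = of_int (\<delta> * d\<^sup>2 + d * \<delta> * (d - 1) - 1)
    + of_int d * (of_int (p - \<delta> * d + 1)
        + of_int (\<delta>\<^sup>2 * (d\<^sup>2 - d)) / of_int (p - \<delta> * d + 1))"
proof -
  define q where "q = p - \<delta> * d + 1"
  have p: "p - \<delta> + 1 = q + \<delta> * (d - 1)"
    by (simp add: q_def algebra_simps)
  have "q \<ge> 1"
    using assms by (simp add: q_def)
  then show ?thesis
    unfolding psi_def p q_def[symmetric]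
    by (simp add: field_simps power2_eq_square)
qed

text \<open>The sign of the difference is decided by comparing \<open>K\<close> with the product of the two
  arguments; this replaces a study of the derivative.\<close>

lemma add_divide_diff:
  fixes K a b :: real
  assumes "a > 0" and "b > 0"
  shows "(b + K / b) - (a + K / a) = (b - a) * (a * b - K) / (a * b)"
  using assms by (simp add: field_simps)

lemma add_divide_mono:
  fixes K a b :: real
  assumes "0 < a" "a \<le> b" "K \<le> a * b"
  shows "a + K / a \<le> b + K / b"
proof -
  have "(b - a) * (a * b - K) / (a * b) \<ge> 0"
    using assms by simp
  then show ?thesis
    using add_divide_diff[of a b K] assms by linarith
qed

lemma add_divide_antimono:
  fixes K a b :: real
  assumes "0 < a" "a \<le> b" "a * b \<le> K"
  shows "b + K / b \<le> a + K / a"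
proof -
  have "(b - a) * (a * b - K) / (a * b) \<le> 0"
    using assms by (intro divide_nonpos_pos mult_nonneg_nonpos) auto
  then show ?thesis
    using add_divide_diff[of a b K] assms by linarith
qed

lemma psi_mono:
  assumes "d \<ge> 0" "p \<ge> \<delta> * d" "p \<le> p'"
    and "\<delta>\<^sup>2 * (d\<^sup>2 - d) \<le> (p - \<delta> * d + 1) * (p' - \<delta> * d + 1)"
  shows "psi d \<delta> p \<le> psi d \<delta> p'"
proof -
  have "real_of_int (\<delta>\<^sup>2 * (d\<^sup>2 - d)) \<le> of_int (p - \<delta> * d + 1) * of_int (p' - \<delta> * d + 1)"
    using assms(4) by (simp only: of_int_mult[symmetric] of_int_le_iff)
  then have "real_of_int (p - \<delta> * d + 1) + of_int (\<delta>\<^sup>2 * (d\<^sup>2 - d)) / of_int (p - \<delta> * d + 1)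
      \<le> of_int (p' - \<delta> * d + 1) + of_int (\<delta>\<^sup>2 * (d\<^sup>2 - d)) / of_int (p' - \<delta> * d + 1)"
    using assms(2,3) by (intro add_divide_mono) (simp_all only: of_int_0_less_iff of_int_le_iff)
  then show ?thesis
    using assms(1-3) by (simp only: psi_eq order.trans add_le_cancel_left mult_left_mono of_int_0_le_iff)
qed

lemma psi_antimono:
  assumes "d \<ge> 0" "p \<ge> \<delta> * d" "p \<le> p'"
    and "(p - \<delta> * d + 1) * (p' - \<delta> * d + 1) \<le> \<delta>\<^sup>2 * (d\<^sup>2 - d)"
  shows "psi d \<delta> p' \<le> psi d \<delta> p"
proof -
  have "real_of_int (p - \<delta> * d + 1) * of_int (p' - \<delta> * d + 1) \<le> of_int (\<delta>\<^sup>2 * (d\<^sup>2 - d))"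
    using assms(4) by (simp only: of_int_mult[symmetric] of_int_le_iff)
  then have "real_of_int (p' - \<delta> * d + 1) + of_int (\<delta>\<^sup>2 * (d\<^sup>2 - d)) / of_int (p' - \<delta> * d + 1)
      \<le> of_int (p - \<delta> * d + 1) + of_int (\<delta>\<^sup>2 * (d\<^sup>2 - d)) / of_int (p - \<delta> * d + 1)"
    using assms(2,3) by (intro add_divide_antimono) (simp_all only: of_int_0_less_iff of_int_le_iff)
  then show ?thesis
    using assms(1-3) by (simp only: psi_eq order.trans add_le_cancel_left mult_left_mono of_int_0_le_iff)
qed

lemma floor_sqrt_bounds:
  fixes K :: int
  assumes "K \<ge> 0"
  shows "\<lfloor>sqrt (of_int K)\<rfloor>\<^sup>2 \<le> K" and "K < (\<lfloor>sqrt (of_int K)\<rfloor> + 1)\<^sup>2"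
proof -
  let ?s = "sqrt (real_of_int K)"
  have s: "?s \<ge> 0" "?s\<^sup>2 = of_int K"
    using assms by simp_all
  have "(real_of_int \<lfloor>?s\<rfloor>)\<^sup>2 \<le> ?s\<^sup>2"
    using s by (intro power_mono) auto
  then have "real_of_int (\<lfloor>?s\<rfloor>\<^sup>2) \<le> of_int K"
    using s by simp
  then show "\<lfloor>?s\<rfloor>\<^sup>2 \<le> K"
    by (simp only: of_int_le_iff)
  have "?s\<^sup>2 < (real_of_int (\<lfloor>?s\<rfloor> + 1))\<^sup>2"
    using s by (intro power_strict_mono) auto
  then have "real_of_int K < of_int ((\<lfloor>?s\<rfloor> + 1)\<^sup>2)"
    using s by simp
  then show "K < (\<lfloor>?s\<rfloor> + 1)\<^sup>2"
    by (simp only: of_int_less_iff)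
qed

theorem mainTheorem3:
  fixes d \<delta> :: int
  assumes "d \<ge> 1" and "\<delta> \<ge> 1"
  shows "lam d \<delta> \<ge> \<delta> * d \<and> (\<forall>p::int. p \<ge> \<delta> * d \<longrightarrow> psi d \<delta> p \<ge> psi d \<delta> (lam d \<delta>))"
proof (cases "d = 1")
  case True
  then show ?thesis
    by (auto simp: lam_def intro!: psi_mono)
next
  case False
  then have d: "d \<ge> 2"
    using assms by simp
  define K where "K = \<delta>\<^sup>2 * (d\<^sup>2 - d)"
  define k where "k = \<lfloor>sqrt (real_of_int K)\<rfloor>"
  have "1 * 1 \<le> \<delta>\<^sup>2 * (d * (d - 1))"
    using d assms mult_mono[of 1 d 1 "d - 1"] by (intro mult_mono) auto
  then have K: "K \<ge> 1"
    by (simp add: K_def power2_eq_square algebra_simps)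
  then have k: "k \<ge> 1" "k\<^sup>2 \<le> K" "K < (k + 1)\<^sup>2"
    using floor_sqrt_bounds[of K] by (simp_all add: k_def)
  have "sqrt (real_of_int K) = of_int \<delta> * sqrt (of_int (d\<^sup>2 - d))"
    using assms by (simp add: K_def real_sqrt_mult)
  then have p1: "p1 d \<delta> = \<delta> * d - 1 + k"
    by (simp add: p1_def k_def)
  then have p2: "p2 d \<delta> = \<delta> * d + k"
    by (simp add: p2_def)
  have "psi d \<delta> (p1 d \<delta>) \<le> psi d \<delta> p \<or> psi d \<delta> (p2 d \<delta>) \<le> psi d \<delta> p"
    if p: "p \<ge> \<delta> * d" for p
  proof (cases "p \<le> p1 d \<delta>")
    case True
    have "(p - \<delta> * d + 1) * k \<le> k * k"
      using True k p1 by (intro mult_right_mono) auto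
    also have "\<dots> \<le> K"
      using k by (simp add: power2_eq_square)
    finally have "(p - \<delta> * d + 1) * k \<le> K" .
    then have "psi d \<delta> (p1 d \<delta>) \<le> psi d \<delta> p"
      using True p assms by (intro psi_antimono) (simp_all add: p1 K_def)
    then show ?thesis ..
  next
    case False
    have "(k + 1) * (k + 1) \<le> (k + 1) * (p - \<delta> * d + 1)"
      using False k p1 by (intro mult_left_mono) auto
    with k have "K \<le> (k + 1) * (p - \<delta> * d + 1)"
      unfolding power2_eq_square by linarith
    then have "psi d \<delta> (p2 d \<delta>) \<le> psi d \<delta> p"
      using False k p assms p1 by (intro psi_mono) (simp_all add: p2 K_def)
    then show ?thesis ..
  qed
  then show ?thesis
    using False k p1 p2 by (fastforce simp: lam_def)
qed

end
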